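(* Let $Y_n$ be a sequence of finite sets such that $|Y_n|=M_n\to\infty$ as $n\to\infty$, let $T_n:Y_n\to Y_n$ be a sequence of transitive permutations and let $F_n:Y_n\to\mathbb{R}$ be a uniformly integrable sequence. Then for all $\varepsilon,\delta>0$ there exist $N,k\in\mathbb{N}$ such that for all $n>N$ $$\frac1{M_n}\,|U(k,\varepsilon,n)|\ge 1-\delta .$$
   Context: A permutation of a finite set $Z$ is transitive if it is a single cycle of length $|Z|$. The sequence $F_n$ is uniformly integrable if $\lim_{n,k\to\infty}\frac1{M_n}\sum_{\{x\in Y_n:\ |F_n(x)|>k\}}|F_n(x)|=0$. For $m\ge1$, $A_m(F_n,T_n,y)=\frac1m\sum_{i=0}^{m-1}F_n(T_n^iy)$. A finite sequence $s$ of reals admits $k$ $\varepsilon$-fluctuations if there are indices $n_1<n_2<\dots<n_{2k-1}<n_{2k}$ with $|s_{n_{2i-1}}-s_{n_{2i}}|\ge\varepsilon$ for all $1\le i\le k$; the number of $\varepsilon$-fluctuations of $s$ is the largest such $k$. $Fl(\varepsilon,n,y)$ denotes the number of $\varepsilon$-fluctuations of the sequence $\{A_m(F_n,T_n,y)\}_{m=1}^{|Y_n|}$, and $U(k,\varepsilon,n)=\{y\in Y_n:\ Fl(\varepsilon,n,y)\le k\}$. *)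

theory Defs
  imports Complex_Main "HOL-Combinatorics.Orbits"
begin

definition transitive_perm :: "'a set \<Rightarrow> ('a \<Rightarrow> 'a) \<Rightarrow> bool" where
  "transitive_perm Z T \<longleftrightarrow> bij_betw T Z Z \<and> cyclic_on T Z"

text \<open>The limit is a genuine double limit, taken along the product filter.\<close>

definition unif_integrable_seq :: "(nat \<Rightarrow> 'a set) \<Rightarrow> (nat \<Rightarrow> 'a \<Rightarrow> real) \<Rightarrow> bool" where
  "unif_integrable_seq Y F \<longleftrightarrow>
     ((\<lambda>(n, k). (1 / real (card (Y n))) * (\<Sum>x\<in>{x \<in> Y n. \<bar>F n x\<bar> > real k}. \<bar>F n x\<bar>))
        \<longlongrightarrow> 0) (sequentially \<times>\<^sub>F sequentially)"

definition ergodic_avg :: "nat \<Rightarrow> ('a \<Rightarrow> real) \<Rightarrow> ('a \<Rightarrow> 'a) \<Rightarrow> 'a \<Rightarrow> real" where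
  "ergodic_avg m F T y = (1 / real m) * (\<Sum>i<m. F ((T ^^ i) y))"

text \<open>A finite sequence of length \<open>L\<close> is represented by a function \<open>s\<close>, of which only
  the values \<open>s 1, \<dots>, s L\<close> are used.\<close>

definition admits_fluctuations :: "real \<Rightarrow> nat \<Rightarrow> (nat \<Rightarrow> real) \<Rightarrow> nat \<Rightarrow> bool" where
  "admits_fluctuations \<epsilon> L s k \<longleftrightarrow>
     (\<exists>j :: nat \<Rightarrow> nat. j ` {1..2 * k} \<subseteq> {1..L} \<and> strict_mono_on {1..2 * k} j \<and>
        (\<forall>i\<in>{1..k}. \<bar>s (j (2 * i - 1)) - s (j (2 * i))\<bar> \<ge> \<epsilon>))"

definition num_fluctuations :: "real \<Rightarrow> nat \<Rightarrow> (nat \<Rightarrow> real) \<Rightarrow> nat" where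
  "num_fluctuations \<epsilon> L s = Max {k. admits_fluctuations \<epsilon> L s k}"

text \<open>The maximum is taken over a finite nonempty set: \<open>k = 0\<close> is always admitted.\<close>

lemma admits_fluctuations_0: "admits_fluctuations \<epsilon> L s 0"
  by (simp add: admits_fluctuations_def)

lemma admits_fluctuations_le:
  assumes "admits_fluctuations \<epsilon> L s k"
  shows "2 * k \<le> L"
proof -
  obtain j :: "nat \<Rightarrow> nat" where "j ` {1..2 * k} \<subseteq> {1..L}" "strict_mono_on {1..2 * k} j"
    using assms unfolding admits_fluctuations_def by blast
  then have "card {1..2 * k} \<le> card {1..L}"
    by (intro card_inj_on_le[of j]) (auto intro: strict_mono_on_imp_inj_on)
  then show ?thesis by simp
qed

lemma finite_admits_fluctuations: "finite {k. admits_fluctuations \<epsilon> L s k}"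
  by (rule finite_subset[of _ "{..L}"]) (auto dest: admits_fluctuations_le)

definition Fl :: "real \<Rightarrow> 'a set \<Rightarrow> ('a \<Rightarrow> 'a) \<Rightarrow> ('a \<Rightarrow> real) \<Rightarrow> 'a \<Rightarrow> nat" where
  "Fl \<epsilon> Z T F y = num_fluctuations \<epsilon> (card Z) (\<lambda>m. ergodic_avg m F T y)"

definition few_fluctuations_set ::
    "nat \<Rightarrow> real \<Rightarrow> 'a set \<Rightarrow> ('a \<Rightarrow> 'a) \<Rightarrow> ('a \<Rightarrow> real) \<Rightarrow> 'a set" where
  "few_fluctuations_set k \<epsilon> Z T F = {y \<in> Z. Fl \<epsilon> Z T F y \<le> k}"

end

theory Submission
  imports Defs
begin

text \<open>
  Averages that stay bounded can oscillate often only by crossing some fixed gap \<open>\<alpha> < \<beta>\<close>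
  upwards often, and Bishop's upcrossing inequality bounds the number of points that do so, with a
  constant that depends neither on the length of the orbit nor on the map.

  For the upcrossing inequality, write \<open>S n x\<close> for the sum of \<open>f\<close> over the first \<open>n\<close> points of the
  orbit of \<open>x\<close>, and let \<open>\<Psi> x\<close> be the largest value of
  \<open>\<Sum>i<r. (S v\<^sub>i x - \<beta> v\<^sub>i) - (S u\<^sub>i x - \<alpha> u\<^sub>i)\<close> over all weakly increasing sequences of times
  \<open>u\<^sub>0 \<le> v\<^sub>0 \<le> u\<^sub>1 \<le> \<dots> \<le> v\<^sub>r\<^sub>-\<^sub>1 \<le> N\<close>. The sum is the gain of a trader who buys at the times
  \<open>u\<^sub>i\<close> and sells at the times \<open>v\<^sub>i\<close>. If all the times are moved one step back and
  \<open>x\<close> is replaced by \<open>T x\<close>, each buy-sell pair with a positive sale time gains \<open>\<beta> - \<alpha>\<close>; the only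
  loss, at most the positive part of \<open>f x - \<alpha>\<close>, comes from a buy at time \<open>0\<close>, which cannot be
  moved. The number of pairs is fixed, so it remains to know that no pair of an optimal
  sequence is spent on the trivial trade \<open>(0, 0)\<close>. This is so when \<open>x\<close> has \<open>r\<close> genuine
  upcrossings (\<open>longer_list_gains_more\<close>): they cannot all be exploited by \<open>r - 1\<close> pairs, hence
  the trivial trade could be exchanged for a profitable one. Summing \<open>\<Psi> (T x) - \<Psi> x\<close> over the
  invariant set gives \<open>0\<close>, and \<open>upcrossing_inequality\<close> follows. One upcrossing that starts at
  time \<open>0\<close> is what the maximal inequality is about, so this is the case \<open>r = 1\<close>.

  Uniform integrability enters through a bound on the means of \<open>\<bar>F n\<bar>\<close>. By the maximal
  inequality, all the averages of most points then lie in one bounded interval \<open>[-K, K]\<close>.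
  Cut this interval into steps of length \<open>h = \<epsilon> / 3\<close>. Each \<open>\<epsilon>\<close>-fluctuation jumps over a whole
  step, upwards or downwards, and there are finitely many steps; so many fluctuations of a
  point force \<open>r\<close> upcrossings of one step by the averages of \<open>f\<close> or of \<open>-f\<close>. The upcrossing
  inequality bounds the proportion of such points by a constant over \<open>r\<close>.
\<close>

section \<open>Alternating gains\<close>

fun gain :: "(nat \<Rightarrow> real) \<Rightarrow> (nat \<Rightarrow> real) \<Rightarrow> nat list \<Rightarrow> real" where
  "gain A B (u # v # xs) = (B v - A u) + gain A B xs"
| "gain A B _ = 0"

fun alternates :: "(nat \<Rightarrow> bool) \<Rightarrow> (nat \<Rightarrow> bool) \<Rightarrow> nat list \<Rightarrow> bool" where
  "alternates P Q (u # v # xs) \<longleftrightarrow> P u \<and> Q v \<and> alternates P Q xs"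
| "alternates P Q [u] \<longleftrightarrow> False"
| "alternates P Q [] \<longleftrightarrow> True"

text \<open>
  A list of \<open>k\<close> pairs cannot exploit \<open>k + 1\<close> profitable pairs. Either some profitable pair lies
  between two trades and can be added as a new trade, or two consecutive profitable pairs
  \<open>(u\<^sub>1, v\<^sub>1)\<close>, \<open>(u\<^sub>2, v\<^sub>2)\<close> satisfy \<open>u \<le> v\<^sub>1 < u\<^sub>2 \<le> v\<close> for a trade \<open>(u, v)\<close>, which is then
  improved by selling at \<open>v\<^sub>1\<close> and buying back at \<open>u\<^sub>2\<close>. The lower bound \<open>l\<close> keeps the list
  sorted when the induction alters only its tail.
\<close>

lemma longer_list_gains_more:
  assumes "length ys = length xs + 2" and "even (length xs)"
    and "sorted xs" and "sorted_wrt (<) ys"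
    and "set xs \<subseteq> {l..N}" and "set ys \<subseteq> {l..N}"
    and "alternates (\<lambda>u. A u \<le> 0) (\<lambda>v. B v > 0) ys"
  shows "\<exists>zs. length zs = length ys \<and> sorted zs \<and> set zs \<subseteq> {l..N} \<and> gain A B xs < gain A B zs"
  using assms
proof (induction xs arbitrary: l ys rule: induct_list012)
  case 1
  then obtain u v where ys: "ys = [u, v]"
    by (auto simp: numeral_2_eq_2 length_Suc_conv)
  have "A u \<le> 0" "B v > 0" "u < v" "l \<le> u" "v \<le> N" using 1 ys by auto
  then show ?case using ys by (intro exI[of _ "[u, v]"]) auto
next
  case (2 x)
  then show ?case by simp
next
  case (3 u v xs)
  from 3(3) obtain u1 v1 u2 v2 ys' where ys: "ys = u1 # v1 # u2 # v2 # ys'"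
    by (auto simp: numeral_2_eq_2 length_Suc_conv)
  have A1: "A u1 \<le> 0" "B v1 > 0" "A u2 \<le> 0" "B v2 > 0"
    and alt: "alternates (\<lambda>u. A u \<le> 0) (\<lambda>v. B v > 0) (u2 # v2 # ys')"
    using "3.prems"(7) by (simp_all add: ys)
  have ord: "u1 < v1" "v1 < u2" "u2 < v2" "l \<le> u1" "v1 \<le> N" "u2 \<le> N"
    and sys: "sorted_wrt (<) (u2 # v2 # ys')"
    and ys': "set ys' \<subseteq> {l..N}" "\<forall>y\<in>set ys'. v2 < y" "v2 \<le> N"
    using "3.prems"(4,6) by (simp_all add: ys)
  have uv: "u \<le> v" "l \<le> u" "v \<le> N"
    and xs: "sorted xs" "\<forall>x\<in>set xs. v \<le> x" "\<forall>x\<in>set xs. u \<le> x" "set xs \<subseteq> {l..N}"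
    using "3.prems"(3,5) by (simp_all add: ball_conj_distrib)
  have len: "length ys' = length xs" "even (length xs)"
    using "3.prems"(1,2) by (simp_all add: ys)
  consider (before) "v1 \<le> u" | (split) "u < v1" "u2 \<le> v" | (later) "v < u2" by linarith
  then show ?case
  proof cases
    case before
    have "\<forall>x\<in>set xs. u1 \<le> x \<and> v1 \<le> x" using xs(3) before ord by force
    then show ?thesis using before uv xs len A1 ord
      by (intro exI[of _ "u1 # v1 # u # v # xs"]) (simp add: ys)
  next
    case split
    have "\<forall>x\<in>set xs. v1 \<le> x \<and> u2 \<le> x" using xs(2) split ord by force
    then show ?thesis using split uv xs len A1 ord
      by (intro exI[of _ "u # v1 # u2 # v # xs"]) (simp add: ys)
  next
    case later
    have above: "\<forall>y\<in>set ys'. v \<le> y" using ys'(2) ord later by force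
    have "\<exists>zs. length zs = length (u2 # v2 # ys') \<and> sorted zs \<and> set zs \<subseteq> {v..N}
        \<and> gain A B xs < gain A B zs"
    proof (rule "3.IH"(1)[OF _ len(2) xs(1) sys _ _ alt])
      show "length (u2 # v2 # ys') = length xs + 2" using len by simp
      show "set xs \<subseteq> {v..N}" using xs by auto
      show "set (u2 # v2 # ys') \<subseteq> {v..N}" using ys' above ord later by (simp add: subset_iff)
    qed
    then obtain zs where zs: "length zs = length (u2 # v2 # ys')" "sorted zs" "set zs \<subseteq> {v..N}"
      "gain A B xs < gain A B zs" by blast
    have "\<forall>z\<in>set zs. v \<le> z \<and> u \<le> z \<and> l \<le> z \<and> z \<le> N" using zs(3) uv by force
    then show ?thesis using zs uv
      by (intro exI[of _ "u # v # zs"]) (auto simp: ys)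
  qed
qed

section \<open>The upcrossing inequality\<close>

definition birkhoff_sum :: "('a \<Rightarrow> real) \<Rightarrow> ('a \<Rightarrow> 'a) \<Rightarrow> nat \<Rightarrow> 'a \<Rightarrow> real" where
  "birkhoff_sum f T n x = (\<Sum>i<n. f ((T ^^ i) x))"

lemma birkhoff_sum_0 [simp]: "birkhoff_sum f T 0 x = 0"
  by (simp add: birkhoff_sum_def)

lemma birkhoff_sum_shift: "birkhoff_sum f T n (T x) = birkhoff_sum f T (Suc n) x - f x"
  unfolding birkhoff_sum_def sum.lessThan_Suc_shift
  by (simp add: funpow_swap1)

abbreviation excess :: "('a \<Rightarrow> real) \<Rightarrow> ('a \<Rightarrow> 'a) \<Rightarrow> real \<Rightarrow> 'a \<Rightarrow> nat \<Rightarrow> real" where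
  "excess f T c x n \<equiv> birkhoff_sum f T n x - c * real n"

lemma excess_shift:
  "0 < n \<Longrightarrow> excess f T c (T x) (n - 1) = excess f T c x n - (f x - c)"
  by (cases n) (auto simp: birkhoff_sum_shift algebra_simps)

text \<open>
  The effect of \<open>n \<mapsto> n - 1\<close>, \<open>x \<mapsto> T x\<close> on the gain is computed from the front of the list. At
  positive times the buying term drops by \<open>f x - \<alpha>\<close> and the selling term by \<open>f x - \<beta>\<close>, a net gain
  of \<open>\<beta> - \<alpha>\<close> for each pair. Time \<open>0\<close> stays where it is by truncated subtraction: a pair \<open>(0, 0)\<close> then has
  gain \<open>0\<close> before and after, and a pair \<open>(0, v)\<close> with \<open>v > 0\<close>, which occurs at most once in a sorted list
  of pairs, is the only place where \<open>f x - \<alpha>\<close> is not compensated.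
\<close>

abbreviation crossing_gain where
  "crossing_gain f T \<alpha> \<beta> x \<equiv> gain (excess f T \<alpha> x) (excess f T \<beta> x)"

lemma crossing_gain_shift_pos:
  assumes "even (length xs)" "\<forall>n\<in>set xs. 0 < n"
  shows "crossing_gain f T \<alpha> \<beta> (T x) (map (\<lambda>n. n - 1) xs)
       = crossing_gain f T \<alpha> \<beta> x xs + real (length xs div 2) * (\<beta> - \<alpha>)"
  using assms
proof (induction xs rule: induct_list012)
  case (3 u v xs)
  then show ?case
    using excess_shift[of u f T x \<alpha>] excess_shift[of v f T x \<beta>]
    by (simp add: algebra_simps)
qed auto

lemma crossing_gain_shift_first_pos:
  assumes "even (length xs)" "sorted (u # v # xs)" "0 < v"
  shows "crossing_gain f T \<alpha> \<beta> (T x) (map (\<lambda>n. n - 1) (u # v # xs))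
       \<ge> crossing_gain f T \<alpha> \<beta> x (u # v # xs) + real (length xs div 2 + 1) * (\<beta> - \<alpha>)
          - max 0 (f x - \<alpha>)"
proof -
  have "crossing_gain f T \<alpha> \<beta> (T x) (map (\<lambda>n. n - 1) xs)
       = crossing_gain f T \<alpha> \<beta> x xs + real (length xs div 2) * (\<beta> - \<alpha>)"
    using assms by (intro crossing_gain_shift_pos) auto
  moreover have "excess f T \<alpha> (T x) (u - 1) \<le> excess f T \<alpha> x u - (f x - \<alpha>) + max 0 (f x - \<alpha>)"
    by (cases "u = 0") (use excess_shift[of u f T x \<alpha>] in auto)
  ultimately show ?thesis
    using excess_shift[OF assms(3), of f T x \<beta>] by (simp add: algebra_simps)
qed

lemma crossing_gain_shift:
  assumes "even (length xs)" "sorted xs" "\<alpha> \<le> \<beta>"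
  shows "crossing_gain f T \<alpha> \<beta> (T x) (map (\<lambda>n. n - 1) xs)
       \<ge> crossing_gain f T \<alpha> \<beta> x xs - max 0 (f x - \<alpha>)"
  using assms
proof (induction xs rule: induct_list012)
  case (3 u v xs)
  show ?case
  proof (cases "v = 0")
    case True
    then show ?thesis using 3 by auto
  next
    case False
    have "0 \<le> real (length xs div 2 + 1) * (\<beta> - \<alpha>)" using 3 by simp
    moreover have "crossing_gain f T \<alpha> \<beta> (T x) (map (\<lambda>n. n - 1) (u # v # xs))
       \<ge> crossing_gain f T \<alpha> \<beta> x (u # v # xs) + real (length xs div 2 + 1) * (\<beta> - \<alpha>)
          - max 0 (f x - \<alpha>)"
      by (rule crossing_gain_shift_first_pos) (use 3 False in auto)
    ultimately show ?thesis by linarith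
  qed
qed auto

text \<open>
  For \<open>n > 0\<close> the sign of \<open>excess f T c x n\<close> tells whether the average over \<open>n\<close> points exceeds \<open>c\<close>.
  Working with sums instead of averages also admits \<open>n = 0\<close>, where the excess is \<open>0\<close>: an upcrossing may
  start at time \<open>0\<close>, as the maximal inequality requires.
\<close>

definition upcrosses :: "('a \<Rightarrow> real) \<Rightarrow> ('a \<Rightarrow> 'a) \<Rightarrow> real \<Rightarrow> real \<Rightarrow> nat \<Rightarrow> nat \<Rightarrow> 'a \<Rightarrow> bool" where
  "upcrosses f T \<alpha> \<beta> N r x \<longleftrightarrow> (\<exists>ys. length ys = 2 * r \<and> sorted_wrt (<) ys \<and> set ys \<subseteq> {0..N} \<and>
     alternates (\<lambda>u. excess f T \<alpha> x u \<le> 0) (\<lambda>v. excess f T \<beta> x v > 0) ys)"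

text \<open>
  Summed over the invariant set, the increments \<open>\<Psi> (T x) - \<Psi> x\<close> of the optimal gain vanish, while
  each point with \<open>r\<close> upcrossings contributes at least \<open>r (\<beta> - \<alpha>)\<close> up to the error
  \<open>max 0 (f x - \<alpha>)\<close>.
\<close>

theorem upcrossing_inequality:
  fixes f :: "'a \<Rightarrow> real"
  assumes fin: "finite Y" and bij: "bij_betw T Y Y" and le: "\<alpha> \<le> \<beta>"
  shows "real r * (\<beta> - \<alpha>) * real (card {x\<in>Y. upcrosses f T \<alpha> \<beta> N r x})
       \<le> (\<Sum>x\<in>Y. max 0 (f x - \<alpha>))"
proof -
  define L where "L = {xs. sorted xs \<and> length xs = 2 * r \<and> set xs \<subseteq> {0..N}}"
  define \<Psi> where "\<Psi> x = Max (crossing_gain f T \<alpha> \<beta> x ` L)" for x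
  define E where "E = {x\<in>Y. upcrosses f T \<alpha> \<beta> N r x}"
  have finL: "finite L"
    by (rule finite_subset[OF _ finite_lists_length_eq[of "{0..N}" "2 * r"]]) (auto simp: L_def)
  have "replicate (2 * r) 0 \<in> L" by (auto simp: L_def)
  then have neL: "L \<noteq> {}" by blast
  have ub: "crossing_gain f T \<alpha> \<beta> x xs \<le> \<Psi> x" if "xs \<in> L" for x xs
    unfolding \<Psi>_def using finL that by (intro Max_ge) auto
  have shiftL: "map (\<lambda>n. n - 1) xs \<in> L" if "xs \<in> L" for xs
    using that by (auto simp: L_def sorted_iff_nth_mono diff_le_mono subset_iff)
  have step: "\<Psi> x - max 0 (f x - \<alpha>) + (if x \<in> E then real r * (\<beta> - \<alpha>) else 0) \<le> \<Psi> (T x)" for x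
  proof -
    have "\<Psi> x \<in> crossing_gain f T \<alpha> \<beta> x ` L"
      unfolding \<Psi>_def using finL neL by (intro Max_in) auto
    then obtain xs where xs: "xs \<in> L" "\<Psi> x = crossing_gain f T \<alpha> \<beta> x xs" by blast
    have sxs: "sorted xs" "length xs = 2 * r" "set xs \<subseteq> {0..N}" using xs(1) by (auto simp: L_def)
    have next_ge: "crossing_gain f T \<alpha> \<beta> (T x) (map (\<lambda>n. n - 1) xs) \<le> \<Psi> (T x)"
      by (intro ub shiftL xs)
    show ?thesis
    proof (cases "x \<in> E \<and> r > 0")
      case False
      then show ?thesis
        using crossing_gain_shift[of xs \<alpha> \<beta> f T x] next_ge sxs le xs(2) by auto
    next
      case True
      then obtain ys where ys: "length ys = 2 * r" "sorted_wrt (<) ys" "set ys \<subseteq> {0..N}"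
        "alternates (\<lambda>u. excess f T \<alpha> x u \<le> 0) (\<lambda>v. excess f T \<beta> x v > 0) ys"
        by (auto simp: E_def upcrosses_def)
      obtain u v xs' where x3: "xs = u # v # xs'"
        using True sxs(2) by (cases r; auto simp: length_Suc_conv)
      then have len: "length xs' = 2 * (r - 1)" using sxs(2) True by auto
      \<comment> \<open>An optimal list that starts with the pair \<open>(0, 0)\<close> gains no more than \<open>r - 1\<close> pairs can,
        and the upcrossings of \<open>x\<close> provide something better.\<close>
      have "v \<noteq> 0"
      proof
        assume "v = 0"
        then have "u = 0" and eq: "\<Psi> x = crossing_gain f T \<alpha> \<beta> x xs'"
          using sxs xs(2) x3 by auto
        obtain zs where "length zs = length ys" "sorted zs" "set zs \<subseteq> {0..N}"
          "crossing_gain f T \<alpha> \<beta> x xs' < crossing_gain f T \<alpha> \<beta> x zs"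
          using longer_list_gains_more[of ys xs' 0 N "excess f T \<alpha> x" "excess f T \<beta> x"]
            ys sxs x3 len by auto
        then show False using ub[of zs x] eq ys(1) by (simp add: L_def)
      qed
      moreover have "length xs' div 2 + 1 = r" "even (length xs')" using len True by auto
      ultimately have "crossing_gain f T \<alpha> \<beta> (T x) (map (\<lambda>n. n - 1) xs)
          \<ge> \<Psi> x + real r * (\<beta> - \<alpha>) - max 0 (f x - \<alpha>)"
        using crossing_gain_shift_first_pos[of xs' u v f T x \<alpha> \<beta>] sxs(1)
        unfolding xs(2) x3 by simp
      then show ?thesis using next_ge True by simp
    qed
  qed
  have "(\<Sum>x\<in>Y. \<Psi> x) - (\<Sum>x\<in>Y. max 0 (f x - \<alpha>)) + (\<Sum>x\<in>Y. if x \<in> E then real r * (\<beta> - \<alpha>) else 0)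
      \<le> (\<Sum>x\<in>Y. \<Psi> (T x))"
    unfolding sum_subtractf[symmetric] sum.distrib[symmetric] by (intro sum_mono step)
  moreover have "(\<Sum>x\<in>Y. \<Psi> (T x)) = (\<Sum>x\<in>Y. \<Psi> x)"
    by (rule sum.reindex_bij_betw[OF bij])
  moreover have "(\<Sum>x\<in>Y. if x \<in> E then real r * (\<beta> - \<alpha>) else 0) = real r * (\<beta> - \<alpha>) * real (card E)"
  proof -
    have "Y \<inter> E = E" by (auto simp: E_def)
    then show ?thesis using fin by (simp add: sum.If_cases Int_def[symmetric] mult.commute)
  qed
  ultimately show ?thesis unfolding E_def by linarith
qed

text \<open>
  A large average of \<open>\<bar>f\<bar>\<close> over \<open>m\<close> points is an upcrossing of the gap from \<open>0\<close> to \<open>K\<close>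
  between the times \<open>0\<close> and \<open>m\<close>.
\<close>

corollary maximal_inequality:
  fixes f :: "'a \<Rightarrow> real"
  assumes "finite Y" and "bij_betw T Y Y" and "0 \<le> K"
  shows "K * real (card {x\<in>Y. \<exists>m\<in>{1..N}. \<bar>ergodic_avg m f T x\<bar> > K}) \<le> (\<Sum>x\<in>Y. \<bar>f x\<bar>)"
proof -
  let ?g = "\<lambda>x. \<bar>f x\<bar>"
  have "{x\<in>Y. \<exists>m\<in>{1..N}. \<bar>ergodic_avg m f T x\<bar> > K} \<subseteq> {x\<in>Y. upcrosses ?g T 0 K N 1 x}"
  proof safe
    fix x m assume m: "m \<in> {1..N}" "\<bar>ergodic_avg m f T x\<bar> > K"
    have "K * real m < \<bar>birkhoff_sum f T m x\<bar>"
      using m by (simp add: ergodic_avg_def birkhoff_sum_def field_simps)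
    also have "\<dots> \<le> birkhoff_sum ?g T m x"
      unfolding birkhoff_sum_def by (rule sum_abs)
    finally show "upcrosses ?g T 0 K N 1 x"
      unfolding upcrosses_def using m by (intro exI[of _ "[0, m]"]) auto
  qed
  then have "card {x\<in>Y. \<exists>m\<in>{1..N}. \<bar>ergodic_avg m f T x\<bar> > K}
      \<le> card {x\<in>Y. upcrosses ?g T 0 K N 1 x}"
    using assms(1) by (intro card_mono) auto
  then have "K * real (card {x\<in>Y. \<exists>m\<in>{1..N}. \<bar>ergodic_avg m f T x\<bar> > K})
      \<le> K * real (card {x\<in>Y. upcrosses ?g T 0 K N 1 x})"
    using assms(3) by (intro mult_left_mono) auto
  also have "\<dots> \<le> (\<Sum>x\<in>Y. max 0 (\<bar>f x\<bar>))"
    using upcrossing_inequality[OF assms, where r = 1 and f = ?g and N = N] by simp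
  finally show ?thesis by simp
qed

section \<open>From fluctuations to upcrossings\<close>

text \<open>
  An interval of length \<open>3 h\<close> contains a step \<open>[l h, (l + 1) h]\<close> of the grid in its interior;
  length \<open>2 h\<close> would allow an end point to be hit, and \<open>upcrosses\<close> demands strict inequality at the
  upper end. A downward jump is an upward jump after multiplication by \<open>\<sigma> = -1\<close>, which maps
  the grid to itself.
\<close>

lemma jump_crosses_level:
  fixes a b h :: real
  assumes "0 < h" and "\<bar>a - b\<bar> \<ge> 3 * h"
    and "\<bar>a\<bar> \<le> K" and "\<bar>b\<bar> \<le> K"
  shows "\<exists>\<sigma>\<in>{1, -1}. \<exists>l\<in>{- \<lceil>K / h\<rceil>..\<lceil>K / h\<rceil>}. \<sigma> * a < of_int l * h \<and> of_int (l + 1) * h < \<sigma> * b"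
proof -
  obtain \<sigma> :: real where \<sigma>: "\<sigma> \<in> {1, -1}" "\<sigma> * b - \<sigma> * a \<ge> 3 * h"
    using assms(2) by (cases "a \<le> b") (auto intro: that[of 1] that[of "-1"])
  have bd: "\<bar>\<sigma> * a\<bar> \<le> K" "\<bar>\<sigma> * b\<bar> \<le> K" using \<sigma>(1) assms by auto
  define l where "l = \<lfloor>\<sigma> * a / h\<rfloor> + 1"
  have l: "\<sigma> * a / h < of_int l" "of_int l \<le> \<sigma> * a / h + 1"
    unfolding l_def by linarith+
  have l1: "\<sigma> * a < of_int l * h" "of_int l * h \<le> \<sigma> * a + h"
    using l assms(1) by (auto simp: field_simps)
  then have l2: "of_int (l + 1) * h < \<sigma> * b"
    using \<sigma>(2) assms(1) by (simp add: algebra_simps)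
  have "of_int l * h < K" "- K < of_int l * h" using l1 l2 bd assms(1) by (auto simp: algebra_simps)
  then have "of_int l < K / h" "- (K / h) < of_int l" using assms(1) by (auto simp: field_simps)
  then have "l \<in> {- \<lceil>K / h\<rceil>..\<lceil>K / h\<rceil>}"
    by (auto simp: le_ceiling_iff) linarith+
  then show ?thesis using \<sigma>(1) l1(1) l2 by blast
qed

lemma consecutive_pairs_alternate:
  fixes j :: "nat \<Rightarrow> nat"
  assumes "sorted_wrt (<) ix" and "set ix \<subseteq> {1..k}" and "strict_mono_on {1..2 * k} j"
    and "\<forall>i\<in>set ix. P (j (2 * i - 1)) \<and> Q (j (2 * i))"
  defines "ys \<equiv> concat (map (\<lambda>i. [j (2 * i - 1), j (2 * i)]) ix)"
  shows "length ys = 2 * length ix" and "sorted_wrt (<) ys" and "alternates P Q ys"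
    and "set ys \<subseteq> j ` {1..2 * k}"
proof -
  have "length ys = 2 * length ix \<and> sorted_wrt (<) ys \<and> alternates P Q ys \<and> set ys \<subseteq> j ` {1..2 * k}"
    using assms(1,2,4) unfolding ys_def
  proof (induction ix)
    case (Cons i ix)
    have less: "j m < j n" if "m \<in> {1..2 * k}" "n \<in> {1..2 * k}" "m < n" for m n
      using strict_mono_onD[OF assms(3)] that by blast
    have "j (2 * i - 1) < j (2 * i)" using Cons.prems by (intro less) auto
    moreover have "j (2 * i) < j (2 * i' - 1)" "j (2 * i) < j (2 * i')"
      "j (2 * i - 1) < j (2 * i' - 1)" "j (2 * i - 1) < j (2 * i')" if "i' \<in> set ix" for i'
    proof -
      have "i < i'" "i' \<le> k" "1 \<le> i" using Cons.prems that by auto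
      then show "j (2 * i) < j (2 * i' - 1)" "j (2 * i) < j (2 * i')"
        "j (2 * i - 1) < j (2 * i' - 1)" "j (2 * i - 1) < j (2 * i')"
        by (auto intro!: less)
    qed
    moreover have "j (2 * i - 1) \<in> j ` {1..2 * k}" "j (2 * i) \<in> j ` {1..2 * k}"
      using Cons.prems by (auto intro!: imageI)
    ultimately show ?case using Cons by auto
  qed simp
  then show "length ys = 2 * length ix" "sorted_wrt (<) ys" "alternates P Q ys"
    "set ys \<subseteq> j ` {1..2 * k}" by auto
qed

text \<open>
  Pigeonhole: each of the \<open>k\<close> fluctuations crosses some signed step of the grid, so that \<open>r\<close> of them
  cross the same one. They remain disjoint and ordered, hence form a list of \<open>r\<close> upcrossings.
\<close>

lemma many_fluctuations_imp_upcrosses: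
  assumes "0 < h" and bd: "\<forall>m\<in>{1..L}. \<bar>ergodic_avg m f T x\<bar> \<le> K"
    and adm: "admits_fluctuations (3 * h) L (\<lambda>m. ergodic_avg m f T x) k"
    and C: "C = {1, -1} \<times> {- \<lceil>K / h\<rceil>..\<lceil>K / h\<rceil>}"
    and large: "card C * r < k"
  shows "\<exists>(\<sigma>, l)\<in>C. upcrosses (\<lambda>y. \<sigma> * f y) T (of_int l * h) (of_int (l + 1) * h) L r x"
proof -
  let ?s = "\<lambda>m. ergodic_avg m f T x"
  from adm obtain j where j: "j ` {1..2 * k} \<subseteq> {1..L}" "strict_mono_on {1..2 * k} j"
    "\<forall>i\<in>{1..k}. \<bar>?s (j (2 * i - 1)) - ?s (j (2 * i))\<bar> \<ge> 3 * h"
    unfolding admits_fluctuations_def by blast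
  have jL: "j (2 * i - 1) \<in> {1..L}" "j (2 * i) \<in> {1..L}" if "i \<in> {1..k}" for i
  proof -
    have "2 * i - 1 \<in> {1..2 * k}" "2 * i \<in> {1..2 * k}" using that by auto
    then show "j (2 * i - 1) \<in> {1..L}" "j (2 * i) \<in> {1..L}" using j(1) by blast+
  qed
  define crosses where "crosses i = (\<lambda>(\<sigma>, l). \<sigma> * ?s (j (2 * i - 1)) < of_int l * h
      \<and> of_int (l + 1) * h < \<sigma> * ?s (j (2 * i)))" for i
  have "\<exists>c\<in>C. crosses i c" if "i \<in> {1..k}" for i
    using jump_crosses_level[OF assms(1), of "?s (j (2 * i - 1))" "?s (j (2 * i))" K]
      j(3) bd jL[OF that] that
    unfolding C crosses_def by fastforce
  then obtain c where c: "\<And>i. i \<in> {1..k} \<Longrightarrow> c i \<in> C \<and> crosses i (c i)" by metis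
  have finC: "finite C" by (simp add: C)
  have "\<exists>p\<in>C. r \<le> card {i\<in>{1..k}. c i = p}"
  proof (rule ccontr)
    assume "\<not> ?thesis"
    then have small: "card {i\<in>{1..k}. c i = p} \<le> r" if "p \<in> C" for p using that by auto
    have "{1..k} = (\<Union>p\<in>C. {i\<in>{1..k}. c i = p})" using c by auto
    then have "k = card (\<Union>p\<in>C. {i\<in>{1..k}. c i = p})" by (metis card_atLeastAtMost diff_Suc_1)
    also have "\<dots> \<le> (\<Sum>p\<in>C. card {i\<in>{1..k}. c i = p})" by (rule card_UN_le[OF finC])
    also have "\<dots> \<le> card C * r" using sum_mono[OF small, of C "\<lambda>p. p"] by simp
    finally show False using large by simp
  qed
  then obtain p where p: "p \<in> C" "r \<le> card {i\<in>{1..k}. c i = p}" by blast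
  from p(2) obtain I where I: "I \<subseteq> {i\<in>{1..k}. c i = p}" "card I = r" "finite I"
    by (elim obtain_subset_with_card_n)
  obtain \<sigma> l where pl: "p = (\<sigma>, l)" by force
  let ?g = "\<lambda>y. \<sigma> * f y"
  let ?ys = "concat (map (\<lambda>i. [j (2 * i - 1), j (2 * i)]) (sorted_list_of_set I))"
  have excess_avg: "excess ?g T b x m = real m * (\<sigma> * ?s m - b)" if "m \<in> {1..L}" for m b
    using that by (simp add: ergodic_avg_def birkhoff_sum_def sum_distrib_left field_simps)
  have PQ: "excess ?g T (of_int l * h) x (j (2 * i - 1)) \<le> 0
      \<and> excess ?g T (of_int (l + 1) * h) x (j (2 * i)) > 0" if "i \<in> I" for i
  proof -
    have i: "i \<in> {1..k}" "c i = p" using that I by auto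
    have "\<sigma> * ?s (j (2 * i - 1)) < of_int l * h" "of_int (l + 1) * h < \<sigma> * ?s (j (2 * i))"
      using c[OF i(1)] i(2) pl by (auto simp: crosses_def)
    then show ?thesis
      unfolding excess_avg[OF jL(1)[OF i(1)]] excess_avg[OF jL(2)[OF i(1)]]
      using jL[OF i(1)] by (auto simp: mult_le_0_iff)
  qed
  have "sorted_wrt (<) (sorted_list_of_set I)" "set (sorted_list_of_set I) \<subseteq> {1..k}"
    "\<forall>i\<in>set (sorted_list_of_set I). excess ?g T (of_int l * h) x (j (2 * i - 1)) \<le> 0
      \<and> excess ?g T (of_int (l + 1) * h) x (j (2 * i)) > 0"
    using I PQ by auto
  note ys = consecutive_pairs_alternate[OF this(1,2) j(2) this(3)]
  have "set ?ys \<subseteq> {0..L}" using ys(4) j(1) by fastforce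
  then have "upcrosses ?g T (of_int l * h) (of_int (l + 1) * h) L r x"
    unfolding upcrosses_def using ys(1,2,3) I by (intro exI[of _ ?ys]) auto
  then show ?thesis using p(1) pl by blast
qed

text \<open>
  The number \<open>k\<close> depends on the system only through the bound \<open>B\<close> on the mean of \<open>\<bar>f\<bar>\<close>, which makes
  the estimate uniform along a sequence of systems. Half of \<open>\<delta>\<close> is reserved for the points whose
  averages leave \<open>[-K, K]\<close>, the other half for the points with \<open>r\<close> upcrossings of some
  signed step. Here \<open>D\<close> bounds the mean of the positive part of \<open>\<sigma> f - l h\<close> for all the steps.
\<close>

theorem uniform_fluctuation_bound:
  fixes \<epsilon> \<delta> B :: real
  assumes "0 < \<epsilon>" and "0 < \<delta>" and "0 < B"
  shows "\<exists>k. \<forall>(Y :: 'a set) T f L. finite Y \<longrightarrow> bij_betw T Y Y \<longrightarrow>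
           (\<Sum>y\<in>Y. \<bar>f y\<bar>) \<le> B * real (card Y) \<longrightarrow>
           real (card {y\<in>Y. num_fluctuations \<epsilon> L (\<lambda>m. ergodic_avg m f T y) > k})
             \<le> \<delta> * real (card Y)"
proof -
  define h where "h = \<epsilon> / 3"
  define K where "K = 2 * B / \<delta>"
  define G where "G = \<lceil>K / h\<rceil>"
  define C where "C = {1, -1 :: real} \<times> {- G..G}"
  define D where "D = B + real_of_int G * h"
  have pos: "0 < h" "0 < K" using assms by (auto simp: h_def K_def)
  then have "0 < G" by (simp add: G_def)
  then have "0 < D" using pos assms by (simp add: D_def add_pos_pos)
  have finC: "finite C" by (simp add: C_def)
  obtain r :: nat where r: "2 * real (card C) * D / (h * \<delta>) < real r"
    using reals_Archimedean2 by blast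
  then have "2 * real (card C) * D < real r * (h * \<delta>)"
    using pos assms by (simp add: pos_divide_less_eq)
  then have r': "real (card C) * D \<le> (real r * h) * (\<delta> / 2)" by (simp add: algebra_simps)
  have "0 \<le> 2 * real (card C) * D / (h * \<delta>)" using \<open>0 < D\<close> pos assms by simp
  then have "0 < real r" using r by linarith
  then have rh: "0 < real r * h" using pos by simp
  show ?thesis
  proof (intro exI[of _ "card C * r"] allI impI)
    fix Y :: "'a set" and T f L
    assume Y: "finite Y" and T: "bij_betw T Y Y" and B: "(\<Sum>y\<in>Y. \<bar>f y\<bar>) \<le> B * real (card Y)"
    define M where "M = real (card Y)"
    define big where "big = {y\<in>Y. \<exists>m\<in>{1..L}. \<bar>ergodic_avg m f T y\<bar> > K}"
    define up where "up p = (case p of (\<sigma>, l) \<Rightarrow> {y\<in>Y. upcrosses (\<lambda>y. \<sigma> * f y) T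
        (of_int l * h) (of_int (l + 1) * h) L r y})" for p
    have "K * real (card big) \<le> B * M"
      using maximal_inequality[OF Y T, of K L f] pos B by (simp add: big_def M_def)
    then have card_big: "real (card big) \<le> \<delta> / 2 * M"
      using assms by (simp add: K_def field_simps)
    have card_up: "real r * h * real (card (up p)) \<le> D * M" if "p \<in> C" for p
    proof -
      obtain \<sigma> l where p: "p = (\<sigma>, l)" by force
      have \<sigma>: "\<bar>\<sigma>\<bar> = 1" and "\<bar>l\<bar> \<le> G" using that p by (auto simp: C_def)
      then have l: "\<bar>real_of_int l * h\<bar> \<le> real_of_int G * h"
        using pos by (simp add: abs_mult)
      have "real r * h * real (card (up p)) \<le> (\<Sum>y\<in>Y. max 0 (\<sigma> * f y - of_int l * h))"
        using upcrossing_inequality[OF Y T, of "of_int l * h" "of_int (l + 1) * h" r "\<lambda>y. \<sigma> * f y" L] pos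
        by (simp add: up_def p algebra_simps)
      also have "\<dots> \<le> (\<Sum>y\<in>Y. \<bar>f y\<bar> + real_of_int G * h)"
      proof (rule sum_mono)
        fix y
        have "\<sigma> * f y \<le> \<bar>f y\<bar>" using \<sigma> by (metis abs_ge_self abs_mult mult_1)
        then show "max 0 (\<sigma> * f y - of_int l * h) \<le> \<bar>f y\<bar> + real_of_int G * h" using l by linarith
      qed
      also have "\<dots> \<le> D * M" using B by (simp add: sum.distrib D_def M_def algebra_simps)
      finally show ?thesis .
    qed
    have "real r * h * (\<Sum>p\<in>C. real (card (up p))) \<le> (\<Sum>p\<in>C. D * M)"
      unfolding sum_distrib_left by (intro sum_mono card_up)
    also have "\<dots> = real (card C) * D * M" by simp
    also have "\<dots> \<le> real r * h * (\<delta> / 2) * M"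
      by (intro mult_right_mono r') (simp add: M_def)
    finally have card_ups: "(\<Sum>p\<in>C. real (card (up p))) \<le> \<delta> / 2 * M"
      using mult_le_cancel_left_pos[OF rh] by (simp only: mult.assoc)
    have "{y\<in>Y. num_fluctuations \<epsilon> L (\<lambda>m. ergodic_avg m f T y) > card C * r} \<subseteq> big \<union> (\<Union>p\<in>C. up p)"
    proof
      fix y assume y: "y \<in> {y\<in>Y. num_fluctuations \<epsilon> L (\<lambda>m. ergodic_avg m f T y) > card C * r}"
      let ?s = "\<lambda>m. ergodic_avg m f T y"
      have "num_fluctuations \<epsilon> L ?s \<in> {k. admits_fluctuations \<epsilon> L ?s k}"
        unfolding num_fluctuations_def using admits_fluctuations_0
        by (intro Max_in finite_admits_fluctuations) blast
      then have adm: "admits_fluctuations (3 * h) L ?s (num_fluctuations \<epsilon> L ?s)"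
        by (simp add: h_def)
      show "y \<in> big \<union> (\<Union>p\<in>C. up p)"
      proof (cases "y \<in> big")
        case False
        then have "\<forall>m\<in>{1..L}. \<bar>?s m\<bar> \<le> K" using y by (force simp: big_def)
        from many_fluctuations_imp_upcrosses[OF pos(1) this adm, of C r] y
        show ?thesis by (force simp: up_def C_def G_def)
      qed simp
    qed
    then have "card {y\<in>Y. num_fluctuations \<epsilon> L (\<lambda>m. ergodic_avg m f T y) > card C * r}
        \<le> card (big \<union> (\<Union>p\<in>C. up p))"
      using Y finC by (intro card_mono) (auto simp: big_def up_def)
    also have "\<dots> \<le> card big + (\<Sum>p\<in>C. card (up p))"
      by (rule order_trans[OF card_Un_le add_left_mono[OF card_UN_le[OF finC]]])
    finally have "real (card {y\<in>Y. num_fluctuations \<epsilon> L (\<lambda>m. ergodic_avg m f T y) > card C * r})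
        \<le> real (card big) + (\<Sum>p\<in>C. real (card (up p)))"
      by (simp flip: of_nat_sum of_nat_add)
    also have "\<dots> \<le> \<delta> * M" using card_big card_ups by (simp add: field_simps)
    finally show "real (card {y\<in>Y. num_fluctuations \<epsilon> L (\<lambda>m. ergodic_avg m f T y) > card C * r})
        \<le> \<delta> * real (card Y)" unfolding M_def .
  qed
qed

section \<open>Uniformly integrable sequences\<close>

text \<open>
  The mean of \<open>\<bar>F n\<bar>\<close> is at most \<open>k\<close> plus the contribution of the points where \<open>\<bar>F n\<bar> > k\<close>; the
  latter is below \<open>1\<close> for one fixed \<open>k\<close> and all large \<open>n\<close>.
\<close>

lemma unif_integrable_seq_imp_L1_bounded:
  assumes "\<And>n. finite (Y n)" and "unif_integrable_seq Y F"
  shows "\<exists>B>0. \<exists>N. \<forall>n\<ge>N. (\<Sum>x\<in>Y n. \<bar>F n x\<bar>) \<le> B * real (card (Y n))"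
proof -
  have "\<forall>\<^sub>F (n, k) in sequentially \<times>\<^sub>F sequentially.
      (1 / real (card (Y n))) * (\<Sum>x\<in>{x\<in>Y n. \<bar>F n x\<bar> > real k}. \<bar>F n x\<bar>) < 1"
    using order_tendstoD(2)[OF assms(2)[unfolded unif_integrable_seq_def], of 1]
    by (simp add: case_prod_unfold)
  then obtain P Q where PQ: "eventually P sequentially" "eventually Q sequentially"
    "\<And>n k. P n \<Longrightarrow> Q k \<Longrightarrow>
      (1 / real (card (Y n))) * (\<Sum>x\<in>{x\<in>Y n. \<bar>F n x\<bar> > real k}. \<bar>F n x\<bar>) < 1"
    by (auto simp: eventually_prod_filter)
  from PQ(1) obtain N where N: "\<And>n. n \<ge> N \<Longrightarrow> P n" by (auto simp: eventually_sequentially)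
  from PQ(2) obtain k where k: "Q k" by (auto simp: eventually_sequentially)
  show ?thesis
  proof (intro exI[of _ "1 + real k"] conjI exI[of _ N] allI impI)
    fix n assume "n \<ge> N"
    let ?tail = "{x\<in>Y n. \<bar>F n x\<bar> > real k}"
    have tail: "(\<Sum>x\<in>?tail. \<bar>F n x\<bar>) \<le> real (card (Y n))"
    proof (cases "card (Y n) = 0")
      case True
      then show ?thesis using assms(1)[of n] by simp
    next
      case False
      then show ?thesis using PQ(3)[OF N[OF \<open>n \<ge> N\<close>] k] by (simp add: field_simps)
    qed
    have "(\<Sum>x\<in>Y n. \<bar>F n x\<bar>) \<le> (\<Sum>x\<in>Y n. (if x \<in> ?tail then \<bar>F n x\<bar> else 0) + real k)"
      by (rule sum_mono) auto
    also have "\<dots> = (\<Sum>x\<in>?tail. \<bar>F n x\<bar>) + real k * real (card (Y n))"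
      using assms(1)[of n] by (simp add: sum.distrib sum.inter_filter)
    finally show "(\<Sum>x\<in>Y n. \<bar>F n x\<bar>) \<le> (1 + real k) * real (card (Y n))"
      using tail by (simp add: algebra_simps)
  qed simp
qed

theorem theorem7:
  fixes Y :: "nat \<Rightarrow> 'a set"
    and T :: "nat \<Rightarrow> 'a \<Rightarrow> 'a"
    and F :: "nat \<Rightarrow> 'a \<Rightarrow> real"
  assumes "\<And>n. finite (Y n)"
    and "filterlim (\<lambda>n. card (Y n)) at_top sequentially"
    and "\<And>n. transitive_perm (Y n) (T n)"
    and "unif_integrable_seq Y F"
  shows "\<forall>\<epsilon>>0. \<forall>\<delta>>0. \<exists>N k :: nat. \<forall>n>N.
           (1 / real (card (Y n))) * real (card (few_fluctuations_set k \<epsilon> (Y n) (T n) (F n)))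
             \<ge> 1 - \<delta>"
proof (intro allI impI)
  fix \<epsilon> \<delta> :: real assume "0 < \<epsilon>" "0 < \<delta>"
  obtain B N1 where B: "0 < B"
    "\<And>n. n \<ge> N1 \<Longrightarrow> (\<Sum>x\<in>Y n. \<bar>F n x\<bar>) \<le> B * real (card (Y n))"
    using unif_integrable_seq_imp_L1_bounded[OF assms(1,4)] by blast
  \<comment> \<open>On an empty set the proportion would be \<open>0\<close>, by division by zero.\<close>
  have "\<forall>\<^sub>F n in sequentially. card (Y n) \<ge> 1"
    using assms(2) by (simp add: filterlim_at_top)
  then obtain N2 where N2: "\<And>n. n \<ge> N2 \<Longrightarrow> card (Y n) \<ge> 1"
    by (auto simp: eventually_sequentially)
  from uniform_fluctuation_bound[OF \<open>0 < \<epsilon>\<close> \<open>0 < \<delta>\<close> B(1), where 'a = 'a]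
  obtain k where k: "\<forall>(Z :: 'a set) S f L. finite Z \<longrightarrow> bij_betw S Z Z \<longrightarrow>
      (\<Sum>y\<in>Z. \<bar>f y\<bar>) \<le> B * real (card Z) \<longrightarrow>
      real (card {y\<in>Z. num_fluctuations \<epsilon> L (\<lambda>m. ergodic_avg m f S y) > k}) \<le> \<delta> * real (card Z)"
    by (elim exE)
  show "\<exists>N k :: nat. \<forall>n>N.
      (1 / real (card (Y n))) * real (card (few_fluctuations_set k \<epsilon> (Y n) (T n) (F n))) \<ge> 1 - \<delta>"
  proof (rule exI[of _ "max N1 N2"], rule exI[of _ k], intro allI impI)
    fix n assume n: "n > max N1 N2"
    let ?U = "few_fluctuations_set k \<epsilon> (Y n) (T n) (F n)"
    have "?U \<subseteq> Y n" "Y n - ?U = {y\<in>Y n. num_fluctuations \<epsilon> (card (Y n))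
        (\<lambda>m. ergodic_avg m (F n) (T n) y) > k}"
      by (auto simp: few_fluctuations_set_def Fl_def)
    moreover have "bij_betw (T n) (Y n) (Y n)"
      using assms(3) by (simp add: transitive_perm_def)
    ultimately have "real (card (Y n - ?U)) \<le> \<delta> * real (card (Y n))"
      using k[rule_format, of "Y n" "T n" "F n" "card (Y n)"] assms(1)[of n] B(2)[of n] n by simp
    moreover have "real (card (Y n - ?U)) = real (card (Y n)) - real (card ?U)"
      using \<open>?U \<subseteq> Y n\<close> assms(1)[of n]
      by (simp add: card_Diff_subset card_mono finite_subset of_nat_diff)
    ultimately show "(1 / real (card (Y n))) * real (card ?U) \<ge> 1 - \<delta>"
      using N2[of n] n by (simp add: field_simps)
  qed
qed

end
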